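(* Let $f:\mathbb N\to\mathbb C$ be any arithmetic function, let $r$ be a fixed positive integer, and let $x>2$ be any sufficiently large real number. Then $$U_f(x):=\sum_{n\leq x}\frac{1}{n^{r+1}}\sum_{k\in \mathrm{Reg}_n}f(\gcd(k,n))k^r=\frac{1}{2}\sum_{n\leq x}\frac{f(n)}{n}+\frac{1}{r+1}\sum_{m=0}^{\lfloor r/2\rfloor}\binom{r+1}{2m}B_{2m}\sum_{\substack{d\ell\leq x\\ \gcd(d, \ell)=1}}\frac{f(\ell)}{\ell}\,\frac{\phi_{1-2m}(d)}{d}.$$ If, in addition, $f(n)\neq 0$ for every $n\in\mathbb N$, then $$V_f(x):=\sum_{n\leq x}\frac{1}{n^{r}f(n)}\sum_{k\in \mathrm{Reg}_n}f(\gcd(k,n))k^r=\frac{x}{2}-\frac{\theta(x)}{2}-\frac{1}{4}+\frac{1}{r+1}\sum_{m=0}^{\lfloor r/2\rfloor}\binom{r+1}{2m}B_{2m}\sum_{\substack{d\ell\leq x\\ \gcd(d, \ell)=1}}\frac{f(\ell)\,\phi_{1-2m}(d)}{f(d\ell)},$$ where $\theta(x)=x-\lfloor x \rfloor-\tfrac12$.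
   Context: $\mathbb N=\{1,2,3,\dots\}$. Sums over $n\le x$ run over positive integers $n$, and sums over $d\ell\le x$ with $\gcd(d,\ell)=1$ run over ordered pairs $(d,\ell)$ of coprime positive integers with $d\ell\le x$. An integer $k$ is called regular modulo $n$ if there exists an integer $y$ with $k^2y\equiv k \pmod n$. Put $\mathrm{Reg}_n=\{k\in\mathbb N: 1\le k\le n,\ k \text{ is regular modulo } n\}$. $B_m$ denotes the $m$-th Bernoulli number ($B_0=1$, $B_2=1/6$, $\dots$). For every integer $s$, the generalized Jordan totient function is $\phi_s(n)=\sum_{d\mid n}d^s\mu(n/d)=n^s\prod_{p\mid n}(1-p^{-s})$, where $\mu$ is the Möbius function and $p$ runs over primes; here $s$ may be negative, and $\phi_1=\phi$ is Euler's totient function. *)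

theory Defs
  imports Complex_Main "HOL-Number_Theory.Number_Theory"
    "HOL-Computational_Algebra.Squarefree"
begin

definition regular_mod :: "int \<Rightarrow> int \<Rightarrow> bool" where
  "regular_mod k n \<longleftrightarrow> (\<exists>y::int. [k ^ 2 * y = k] (mod n))"

definition Reg :: "nat \<Rightarrow> nat set" where
  "Reg n = {k. 1 \<le> k \<and> k \<le> n \<and> regular_mod (int k) (int n)}"

text \<open>The recursion is \<open>\<Sum>k\<le>m. (m + 1 choose k) * bernoulli k = 0\<close> for \<open>m \<ge> 1\<close>, solved for
  the last term with \<open>m = n + 1\<close>. It gives \<open>bernoulli 1 = - 1 / 2\<close>.\<close>

fun bernoulli :: "nat \<Rightarrow> real" where
  "bernoulli 0 = 1"
| "bernoulli (Suc n) =
     - (\<Sum>k\<le>n. of_nat ((n + 2) choose k) * bernoulli k) / of_nat (n + 2)"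

declare bernoulli.simps(2) [simp del]

definition moebius_mu :: "nat \<Rightarrow> int" where
  "moebius_mu n = (if squarefree n then (- 1) ^ card (prime_factors n) else 0)"

definition jordan_totient :: "int \<Rightarrow> nat \<Rightarrow> real" where
  "jordan_totient s n = (\<Sum>d | d dvd n. of_nat d powi s * of_int (moebius_mu (n div d)))"

definition pos_upto :: "real \<Rightarrow> nat set" where
  "pos_upto x = {n. 1 \<le> n \<and> real n \<le> x}"

definition coprime_pairs_upto :: "real \<Rightarrow> (nat \<times> nat) set" where
  "coprime_pairs_upto x =
     {(d, l). 1 \<le> d \<and> 1 \<le> l \<and> real (d * l) \<le> x \<and> coprime d l}"

definition U_sum :: "(nat \<Rightarrow> complex) \<Rightarrow> nat \<Rightarrow> real \<Rightarrow> complex" where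
  "U_sum f r x =
     (\<Sum>n\<in>pos_upto x. 1 / of_nat n ^ (r + 1) * (\<Sum>k\<in>Reg n. f (gcd k n) * of_nat k ^ r))"

definition V_sum :: "(nat \<Rightarrow> complex) \<Rightarrow> nat \<Rightarrow> real \<Rightarrow> complex" where
  "V_sum f r x =
     (\<Sum>n\<in>pos_upto x. 1 / (of_nat n ^ r * f n) * (\<Sum>k\<in>Reg n. f (gcd k n) * of_nat k ^ r))"

definition theta :: "real \<Rightarrow> real" where
  "theta x = x - of_int \<lfloor>x\<rfloor> - 1 / 2"

end

theory Submission
  imports Defs "HOL-Computational_Algebra.Formal_Power_Series"
begin

text \<open>An integer is regular modulo \<open>n\<close> iff its gcd with \<open>n\<close> is a unitary divisor of \<open>n\<close>, so the pairs
  \<open>(n, k)\<close> with \<open>k\<close> in \<open>Reg n\<close> are exactly \<open>(d * l, l * j)\<close> with \<open>d\<close>, \<open>l\<close> coprime and \<open>j\<close> a totative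
  of \<open>d\<close>. This turns both sums into sums over coprime pairs of the power sum of the totatives of
  \<open>d\<close>, which Moebius inversion and Faulhaber's formula express through the Jordan totients.\<close>

subsection \<open>Faulhaber's formula\<close>

text \<open>The series t / (e^t - 1). It is given by its coefficients, and the quotient form enters
  only as the product identity \<open>bernoulli_fps_mult_exp\<close>.\<close>

definition bernoulli_fps :: "real fps" where
  "bernoulli_fps = Abs_fps (\<lambda>n. bernoulli n / fact n)"

text \<open>The defining recursion with the solved-for term moved back, in the shape of a
  coefficient of B(t) (e^t - 1). Only n = 1, where the sum is the single term B_0, gives a nonzero
  value.\<close>

lemma sum_binomial_bernoulli:
  "(\<Sum>k<n. of_nat (n choose k) * bernoulli k) = (if n = 1 then 1 else 0)"
proof (cases n)
  case (Suc m)
  show ?thesis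
  proof (cases m)
    case (Suc q)
    have "(\<Sum>k<n. of_nat (n choose k) * bernoulli k) =
      (\<Sum>k\<le>q. of_nat ((q + 2) choose k) * bernoulli k) + of_nat (q + 2) * bernoulli (Suc q)"
      using \<open>n = Suc m\<close> Suc by (simp add: lessThan_Suc_atMost del: binomial_Suc_Suc)
    also have "\<dots> = 0"
      by (simp add: bernoulli.simps(2) field_simps del: binomial_Suc_Suc)
    finally show ?thesis using \<open>n = Suc m\<close> Suc by simp
  qed (use Suc in simp)
qed simp

text \<open>Subtracting 1 from e^t removes the term k = n of the Cauchy product, and n! turns the
  remaining factorials into binomial coefficients.\<close>

lemma bernoulli_fps_mult_exp: "bernoulli_fps * (fps_exp 1 - 1) = fps_X"
proof (rule fps_ext)
  fix n
  have "fps_nth (bernoulli_fps * (fps_exp 1 - 1)) n =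
      (\<Sum>k\<in>{0..n}. bernoulli k / fact k * (1 / fact (n - k) - (if n - k = 0 then 1 else 0)))"
    by (simp add: fps_mult_nth bernoulli_fps_def)
  also have "\<dots> = (\<Sum>k\<in>{0..<n}. bernoulli k / fact k * (1 / fact (n - k)))"
    by (intro sum.mono_neutral_cong_right) auto
  also have "\<dots> = (\<Sum>k<n. of_nat (n choose k) * bernoulli k) / fact n"
    by (auto simp: sum_divide_distrib binomial_fact atLeast0LessThan intro!: sum.cong)
  also have "\<dots> = fps_nth fps_X n"
    by (simp add: sum_binomial_bernoulli)
  finally show "fps_nth (bernoulli_fps * (fps_exp 1 - 1)) n = fps_nth fps_X n" .
qed

lemma fps_exp_1_minus_1_nonzero: "fps_exp 1 - 1 \<noteq> (0 :: real fps)"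
proof
  assume "fps_exp 1 - 1 = (0 :: real fps)"
  then have "fps_nth (fps_exp 1 - 1 :: real fps) 1 = fps_nth 0 1" by (rule arg_cong)
  then show False by simp
qed

text \<open>The generating function satisfies \<open>B(-t) = B(t) + t\<close>.\<close>

lemma bernoulli_odd_eq_0:
  assumes "odd n" "n \<noteq> 1"
  shows "bernoulli n = 0"
proof -
  let ?B = bernoulli_fps and ?E = "fps_exp 1 :: real fps"
  define C where "C = ?B oo (- fps_X)"
  have E: "fps_exp (- 1) * ?E = 1"
    by (simp flip: fps_exp_add_mult)
  have "C * (fps_exp (- 1) - 1) = - fps_X"
  proof -
    have "(?B * (?E - 1)) oo (- fps_X) = C * ((?E - 1) oo (- fps_X))"
      unfolding C_def by (rule fps_compose_mult_distrib) simp
    moreover have "?E oo (- fps_X) = fps_exp (- 1)"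
      using fps_exp_compose_linear[of 1 "-1 :: real"] by simp
    ultimately show ?thesis
      by (simp add: bernoulli_fps_mult_exp fps_compose_sub_distrib)
  qed
  \<comment> \<open>Multiplying by e^t turns e^(-t) - 1 into 1 - e^t, so that C and B are compared
    against the same factor.\<close>
  then have "C * (fps_exp (- 1) - 1) * ?E = - fps_X * ?E" by simp
  then have "C * (1 - ?E) = - fps_X * ?E"
    using E by (simp add: algebra_simps)
  then have "C * (?E - 1) = fps_X * ?E"
    by (simp add: algebra_simps)
  also have "\<dots> = ?B * (?E - 1) + fps_X * (?E - 1)"
    unfolding bernoulli_fps_mult_exp by (simp add: algebra_simps)
  finally have "(C - (?B + fps_X)) * (?E - 1) = 0"
    by (simp add: algebra_simps)
  then have "C = ?B + fps_X"
    using fps_exp_1_minus_1_nonzero by simp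
  \<comment> \<open>For odd n other than 1 the coefficients b of B satisfy -b = b.\<close>
  then have "fps_nth C n = fps_nth (?B + fps_X) n" by simp
  moreover have "fps_nth C n = (- 1) ^ n * fps_nth ?B n"
    unfolding C_def using fps_compose_uminus'[of ?B] by simp
  ultimately show ?thesis
    using assms by (simp add: bernoulli_fps_def)
qed

text \<open>The geometric sum of e^(jt) over j < N, times e^t - 1, is e^(Nt) - 1. Multiplying by
  B(t) replaces e^t - 1 by t, and the formula is the coefficient of t^(r+1).\<close>

lemma sum_powers_lessThan:
  "(\<Sum>j<N. real j ^ r) =
     1 / real (r + 1) * (\<Sum>k\<le>r. of_nat ((r + 1) choose k) * bernoulli k * real N ^ (r + 1 - k))"
proof -
  let ?B = bernoulli_fps and ?E = "fps_exp 1 :: real fps"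
  have "(\<Sum>j<N. fps_exp (real j)) * (?E - 1) = fps_exp (real N) - 1"
    by (induction N) (simp_all add: algebra_simps fps_exp_add_mult)
  then have "?B * ((\<Sum>j<N. fps_exp (real j)) * (?E - 1)) = ?B * (fps_exp (real N) - 1)"
    by simp
  then have "fps_X * (\<Sum>j<N. fps_exp (real j)) = ?B * (fps_exp (real N) - 1)"
    by (metis bernoulli_fps_mult_exp mult.assoc mult.commute)
  then have "fps_nth (fps_X * (\<Sum>j<N. fps_exp (real j))) (Suc r) =
      fps_nth (?B * (fps_exp (real N) - 1)) (Suc r)"
    by (rule arg_cong)
  then have "(\<Sum>j<N. real j ^ r) / fact r = (\<Sum>k\<in>{0..Suc r}. bernoulli k / fact k *
      (real N ^ (Suc r - k) / fact (Suc r - k) - (if Suc r - k = 0 then 1 else 0)))"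
    unfolding fps_mult_nth[of bernoulli_fps]
    by (simp add: bernoulli_fps_def fps_sum_nth sum_divide_distrib del: sum.cl_ivl_Suc)
  \<comment> \<open>The term k = r + 1 drops out because e^(Nt) - 1 has no constant term.\<close>
  also have "\<dots> = (\<Sum>k\<le>r. bernoulli k / fact k * (real N ^ (Suc r - k) / fact (Suc r - k)))"
    by (intro sum.mono_neutral_cong_right) (auto simp: le_Suc_eq)
  finally have "(\<Sum>j<N. real j ^ r) =
      fact r * (\<Sum>k\<le>r. bernoulli k / fact k * (real N ^ (Suc r - k) / fact (Suc r - k)))"
    by (simp add: field_simps)
  also have "\<dots> = 1 / real (r + 1) *
      (\<Sum>k\<le>r. of_nat ((r + 1) choose k) * bernoulli k * real N ^ (r + 1 - k))"
    unfolding sum_distrib_left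
  proof (rule sum.cong)
    fix k assume "k \<in> {..r}"
    then have "real ((r + 1) choose k) = real (r + 1) * fact r / (fact k * fact (Suc r - k))"
      by (subst binomial_fact) auto
    then show "fact r * (bernoulli k / fact k * (real N ^ (Suc r - k) / fact (Suc r - k))) =
        1 / real (r + 1) * (of_nat ((r + 1) choose k) * bernoulli k * real N ^ (r + 1 - k))"
      by (simp add: divide_simps del: binomial_Suc_Suc)
  qed simp
  finally show ?thesis .
qed

text \<open>Among odd indices only k = 1 survives, and B_1 = -1/2 makes it contribute -N^r / 2.
  Moving the upper limit from N - 1 to N adds N^r, which flips that sign.\<close>

lemma faulhaber:
  assumes "r \<ge> 1"
  shows "(\<Sum>j=1..N. real j ^ r) = real N ^ r / 2 + 1 / real (r + 1) *
    (\<Sum>m=0..r div 2. of_nat ((r + 1) choose (2 * m)) * bernoulli (2 * m) * real N ^ (r + 1 - 2 * m))"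
    (is "_ = _ + _ * ?R")
proof -
  let ?g = "\<lambda>k. of_nat ((r + 1) choose k) * bernoulli k * real N ^ (r + 1 - k)"
  have "(\<Sum>k\<le>r. ?g k) = ?g 1 + (\<Sum>k\<in>{..r} - {1}. ?g k)"
    using assms by (subst sum.remove[of _ 1]) auto
  also have "(\<Sum>k\<in>{..r} - {1}. ?g k) = (\<Sum>k\<in>(*) 2 ` {0..r div 2}. ?g k)"
  proof (intro sum.mono_neutral_right ballI)
    fix k assume k: "k \<in> {..r} - {1} - ((*) 2 ` {0..r div 2})"
    then have "odd k"
      by (auto simp: image_iff elim!: evenE)
    with k show "?g k = 0" by (simp add: bernoulli_odd_eq_0)
  qed auto
  also have "\<dots> = ?R"
    by (subst sum.reindex) (auto simp: inj_on_def)
  also have "?g 1 = real (r + 1) * - (real N ^ r / 2)"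
    by (simp add: bernoulli.simps(2) algebra_simps)
  finally have "(\<Sum>j<N. real j ^ r) = 1 / real (r + 1) * (real (r + 1) * - (real N ^ r / 2) + ?R)"
    unfolding sum_powers_lessThan by (rule arg_cong)
  then have "(\<Sum>j<N. real j ^ r) = - (real N ^ r / 2) + 1 / real (r + 1) * ?R"
    unfolding distrib_left by (simp del: of_nat_add of_nat_Suc)
  moreover have "(\<Sum>j=1..N. real j ^ r) = (\<Sum>j<N. real j ^ r) + real N ^ r"
  proof -
    \<comment> \<open>The term j = 0 may be inserted because 0^r = 0 for r >= 1.\<close>
    have "(\<Sum>j=1..N. real j ^ r) = (\<Sum>j\<in>{..N}. real j ^ r)"
      using assms by (intro sum.mono_neutral_left) (auto simp: Suc_le_eq)
    then show ?thesis
      by (simp flip: lessThan_Suc_atMost)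
  qed
  ultimately show ?thesis by simp
qed

subsection \<open>Power sums over totatives\<close>

text \<open>A new prime factor preserves squarefreeness and changes the parity of the number of
  prime factors; this drives the cancellation in \<open>sum_moebius_mu\<close>.\<close>

lemma moebius_mu_prime_mult:
  assumes "prime p" "\<not> p dvd d" "d > 0"
  shows "moebius_mu (p * d) = - moebius_mu d"
proof -
  have "coprime p d"
    using assms by (simp add: prime_imp_coprime)
  then have "squarefree (p * d) \<longleftrightarrow> squarefree d"
    using assms squarefree_mult_coprime[of p d] squarefree_multD[of p d] squarefree_prime[of p]
    by auto
  moreover have "prime_factors (p * d) = insert p (prime_factors d)"
    using assms by (auto simp: prime_factors_product prime_factorization_prime)
  moreover have "p \<notin> prime_factors d"
    using assms by auto
  ultimately show ?thesis
    by (simp add: moebius_mu_def)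
qed

text \<open>For a prime \<open>p\<close> dividing \<open>n\<close>, the divisors \<open>d\<close> and \<open>p * d\<close> with \<open>d\<close> prime to \<open>p\<close> cancel, and
  the remaining divisors are not squarefree.\<close>

lemma sum_moebius_mu:
  assumes "n > 0"
  shows "(\<Sum>d | d dvd n. moebius_mu d) = (if n = 1 then 1 else 0)"
proof (cases "n = 1")
  case True
  then show ?thesis by (simp add: moebius_mu_def)
next
  case False
  then obtain p where p: "prime p" "p dvd n"
    using prime_factor_nat by blast
  define A where "A = {d. d dvd n \<and> \<not> p dvd d \<and> p * d dvd n}"
  have fin: "finite {d. d dvd n}"
    using assms by simp
  have *: "p * d dvd n" if "d dvd n" "\<not> p dvd d" for d
    using that p by (intro divides_mult) (auto simp: prime_imp_coprime)
  have pos: "d > 0" if "d \<in> A" for d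
    using that assms by (auto simp: A_def intro!: Nat.gr0I)
  have "(\<Sum>d | d dvd n. moebius_mu d) = (\<Sum>d\<in>A \<union> (*) p ` A. moebius_mu d)"
  proof (rule sum.mono_neutral_right[OF fin])
    show "A \<union> (*) p ` A \<subseteq> {d. d dvd n}"
      by (auto simp: A_def)
    show "\<forall>d\<in>{d. d dvd n} - (A \<union> (*) p ` A). moebius_mu d = 0"
    proof
      fix d assume d: "d \<in> {d. d dvd n} - (A \<union> (*) p ` A)"
      then have "p dvd d" using * by (auto simp: A_def)
      then obtain e where e: "d = p * e" by (elim dvdE)
      have "e \<notin> A" using d e by auto
      moreover have "e dvd n" "p * e dvd n"
        using d e by (auto dest: dvd_mult_right)
      ultimately have "p dvd e" by (auto simp: A_def)
      then have "p ^ 2 dvd d" by (simp add: e power2_eq_square)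
      then have "\<not> squarefree d"
        using p(1) not_prime_unit squarefreeD by blast
      then show "moebius_mu d = 0" by (simp add: moebius_mu_def)
    qed
  qed
  also have "\<dots> = (\<Sum>d\<in>A. moebius_mu d) + (\<Sum>d\<in>(*) p ` A. moebius_mu d)"
    by (intro sum.union_disjoint finite_imageI) (auto simp: A_def intro: finite_subset[OF _ fin])
  also have "(\<Sum>d\<in>(*) p ` A. moebius_mu d) = (\<Sum>d\<in>A. moebius_mu (p * d))"
    using p(1) by (subst sum.reindex) (auto simp: inj_on_def prime_gt_0_nat)
  also have "\<dots> = (\<Sum>d\<in>A. - moebius_mu d)"
    using pos p(1) by (intro sum.cong refl moebius_mu_prime_mult) (auto simp: A_def)
  finally show ?thesis
    using False by (simp add: sum_negf)
qed

lemma sum_divisors_flip: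
  assumes "(n :: nat) > 0"
  shows "(\<Sum>d | d dvd n. g d) = (\<Sum>d | d dvd n. g (n div d))"
  using assms by (intro sum.reindex_bij_witness[of _ "\<lambda>d. n div d" "\<lambda>d. n div d"])
    (auto elim!: dvdE)

text \<open>The indicator of gcd(j, d) = 1 is the sum of mu(e) over the common divisors e of j and
  d. After swapping the sums, the inner one runs over the multiples of e up to d.\<close>

lemma sum_totatives:
  fixes g :: "nat \<Rightarrow> real"
  assumes "d > 0"
  shows "(\<Sum>j\<in>totatives d. g j) =
    (\<Sum>q | q dvd d. of_int (moebius_mu (d div q)) * (\<Sum>i=1..q. g (d div q * i)))"
proof -
  have fin: "finite {e. e dvd d}"
    using assms by simp
  have mu: "(if coprime j d then 1 else 0 :: real) =
      (\<Sum>e | e dvd d. if e dvd j then of_int (moebius_mu e) else 0)" for j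
  proof -
    have "(\<Sum>e | e dvd d. if e dvd j then real_of_int (moebius_mu e) else 0) =
        (\<Sum>e | e dvd gcd j d. real_of_int (moebius_mu e))"
      using fin by (intro sum.mono_neutral_cong_right) auto
    also have "\<dots> = of_int (\<Sum>e | e dvd gcd j d. moebius_mu e)"
      by simp
    also have "\<dots> = (if coprime j d then 1 else 0)"
      unfolding coprime_iff_gcd_eq_1 using assms by (subst sum_moebius_mu) auto
    finally show ?thesis by simp
  qed
  have "(\<Sum>j\<in>totatives d. g j) = (\<Sum>j=1..d. (if coprime j d then 1 else 0) * g j)"
    by (intro sum.mono_neutral_cong_left) (auto simp: totatives_def)
  also have "\<dots> = (\<Sum>e | e dvd d. \<Sum>j=1..d. (if e dvd j then of_int (moebius_mu e) else 0) * g j)"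
    unfolding mu sum_distrib_right by (rule sum.swap)
  also have "\<dots> = (\<Sum>e | e dvd d. of_int (moebius_mu e) * (\<Sum>i=1..d div e. g (e * i)))"
  proof (rule sum.cong)
    fix e assume e: "e \<in> {e. e dvd d}"
    then have "e > 0" using assms by (auto intro!: Nat.gr0I)
    have "(\<Sum>j=1..d. (if e dvd j then of_int (moebius_mu e) else 0) * g j) =
        (\<Sum>j\<in>(*) e ` {1..d div e}. of_int (moebius_mu e) * g j)"
    proof (rule sum.mono_neutral_cong_right)
      show "(*) e ` {1..d div e} \<subseteq> {1..d}"
      proof clarify
        fix i assume i: "i \<in> {1..d div e}"
        then have "e * i \<le> e * (d div e)" by simp
        with i e \<open>e > 0\<close> show "e * i \<in> {1..d}" by simp
      qed
      show "\<forall>j\<in>{1..d} - (*) e ` {1..d div e}.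
          (if e dvd j then of_int (moebius_mu e) else 0) * g j = 0"
      proof
        fix j assume j: "j \<in> {1..d} - (*) e ` {1..d div e}"
        have "\<not> e dvd j"
        proof
          assume "e dvd j"
          then obtain i where "j = e * i" by (elim dvdE)
          moreover from this have "i \<in> {1..d div e}"
            using j \<open>e > 0\<close> by (auto simp: less_eq_div_iff_mult_less_eq mult.commute Suc_le_eq)
          ultimately show False using j by blast
        qed
        then show "(if e dvd j then of_int (moebius_mu e) else 0) * g j = 0" by simp
      qed
    qed auto
    also have "\<dots> = of_int (moebius_mu e) * (\<Sum>i=1..d div e. g (e * i))"
      using \<open>e > 0\<close> by (subst sum.reindex) (auto simp: inj_on_def sum_distrib_left)
    finally show "(\<Sum>j=1..d. (if e dvd j then of_int (moebius_mu e) else 0) * g j) =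
        of_int (moebius_mu e) * (\<Sum>i=1..d div e. g (e * i))" .
  qed simp
  \<comment> \<open>Substituting q = d / e puts mu at d / q, as in
    \<open>jordan_totient\<close>.\<close>
  also have "\<dots> = (\<Sum>q | q dvd d. of_int (moebius_mu (d div q)) * (\<Sum>i=1..q. g (d div q * i)))"
  proof (subst sum_divisors_flip[OF assms], rule sum.cong)
    fix q assume "q \<in> {q. q dvd d}"
    then have "d div (d div q) = q"
      using assms by (auto elim!: dvdE)
    then show "of_int (moebius_mu (d div q)) * (\<Sum>i=1..d div (d div q). g (d div q * i)) =
        of_int (moebius_mu (d div q)) * (\<Sum>i=1..q. g (d div q * i))"
      by simp
  qed simp
  finally show ?thesis .
qed

text \<open>Faulhaber's formula is applied to the sum of i^r over i <= q. Since (d/q)^r q^(r+1-2m) =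
  d^r q^(1-2m), summing against mu(d/q) gives the Jordan totient of order 1 - 2m.\<close>

lemma sum_totatives_power:
  assumes "d > 0" "r \<ge> 1"
  shows "(\<Sum>j\<in>totatives d. real j ^ r) = real d ^ r * ((if d = 1 then 1 / 2 else 0) +
    1 / real (r + 1) * (\<Sum>m=0..r div 2. of_nat ((r + 1) choose (2 * m)) * bernoulli (2 * m) *
      jordan_totient (1 - 2 * int m) d))"
proof -
  let ?\<mu> = "\<lambda>q. real_of_int (moebius_mu (d div q))"
  let ?c = "\<lambda>m. of_nat ((r + 1) choose (2 * m)) * bernoulli (2 * m)"
  have "(\<Sum>j\<in>totatives d. real j ^ r) =
      (\<Sum>q | q dvd d. ?\<mu> q * (real (d div q) ^ r * (\<Sum>i=1..q. real i ^ r)))"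
    by (simp add: sum_totatives[OF assms(1)] power_mult_distrib sum_distrib_left)
  also have "\<dots> = (\<Sum>q | q dvd d. real d ^ r * (?\<mu> q / 2 +
      1 / real (r + 1) * (\<Sum>m=0..r div 2. ?c m * (real q powi (1 - 2 * int m) * ?\<mu> q))))"
  proof (rule sum.cong)
    fix q assume "q \<in> {q. q dvd d}"
    then obtain e where e: "d = q * e" by (auto elim: dvdE)
    have pos: "q > 0" "e > 0" using assms(1) e by auto
    \<comment> \<open>The bound 2m <= r keeps the natural subtraction exact, while 1 - 2m is
      negative for m >= 1 and needs \<open>powi\<close>.\<close>
    have "real q ^ (r + 1 - 2 * m) = real q ^ r * real q powi (1 - 2 * int m)"
      if "m \<le> r div 2" for m
    proof -
      have "2 * m \<le> r" using that by simp
      have "real q ^ r * real q powi (1 - 2 * int m) = real q powi (int r + (1 - 2 * int m))"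
        using pos by (subst power_int_add) auto
      also have "int r + (1 - 2 * int m) = int (r + 1 - 2 * m)"
        using \<open>2 * m \<le> r\<close> by simp
      finally show ?thesis by (simp only: power_int_of_nat)
    qed
    then have *: "(\<Sum>m=0..r div 2. ?c m * real q ^ (r + 1 - 2 * m)) =
        (\<Sum>m=0..r div 2. ?c m * (real q ^ r * real q powi (1 - 2 * int m)))"
      by (intro sum.cong) auto
    show "?\<mu> q * (real (d div q) ^ r * (\<Sum>i=1..q. real i ^ r)) = real d ^ r * (?\<mu> q / 2 +
      1 / real (r + 1) * (\<Sum>m=0..r div 2. ?c m * (real q powi (1 - 2 * int m) * ?\<mu> q)))"
      unfolding faulhaber[OF assms(2)] * using pos e
      by (simp add: power_mult_distrib algebra_simps sum_distrib_left sum_distrib_right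
          sum_divide_distrib)
  qed simp
  also have "\<dots> = real d ^ r * ((\<Sum>q | q dvd d. ?\<mu> q) / 2 + 1 / real (r + 1) *
      (\<Sum>m=0..r div 2. ?c m * (\<Sum>q | q dvd d. real q powi (1 - 2 * int m) * ?\<mu> q)))"
    by (simp only: sum.distrib sum_distrib_left[symmetric] sum_divide_distrib[symmetric]
        sum.swap[of _ "{0..r div 2}"])
  \<comment> \<open>The term q^r / 2 leaves only the sum of mu(d/q), which vanishes unless d = 1. It
    is the source of the term outside the Bernoulli sum in both identities.\<close>
  also have "(\<Sum>q | q dvd d. ?\<mu> q) = (if d = 1 then 1 else 0)"
    using sum_moebius_mu[OF assms(1)] sum_divisors_flip[OF assms(1), of moebius_mu]
    by (simp flip: of_int_sum)
  finally show ?thesis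
    by (simp add: jordan_totient_def)
qed

subsection \<open>Regular integers\<close>

text \<open>With k = l j and n = d l, the difference k^2 y - k is l j (k y - 1). Cancelling l, and
  then j because it is prime to d, leaves k y = 1 modulo d, which is solvable iff l is prime to
  d.\<close>

lemma regular_mod_iff_coprime:
  fixes d l j :: nat
  assumes "l > 0" "coprime j d"
  shows "regular_mod (int (l * j)) (int (d * l)) \<longleftrightarrow> coprime d l"
proof -
  have j: "coprime (int d) (int j)" and l: "int l \<noteq> 0"
    using assms by (auto simp: coprime_commute)
  have "[int (l * j) ^ 2 * y = int (l * j)] (mod int (d * l)) \<longleftrightarrow> [int (l * j) * y = 1] (mod int d)"
    for y
  proof -
    have "int (l * j) ^ 2 * y - int (l * j) = int l * (int j * (int (l * j) * y - 1))"
      by (simp add: power2_eq_square algebra_simps)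
    then have "[int (l * j) ^ 2 * y = int (l * j)] (mod int (d * l)) \<longleftrightarrow>
        int l * int d dvd int l * (int j * (int (l * j) * y - 1))"
      by (simp add: cong_iff_dvd_diff mult.commute)
    also have "\<dots> \<longleftrightarrow> int d dvd int j * (int (l * j) * y - 1)"
      using l by (simp only: dvd_mult_cancel_left) simp
    also have "\<dots> \<longleftrightarrow> int d dvd int (l * j) * y - 1"
      using j by (simp only: coprime_dvd_mult_right_iff)
    finally show ?thesis by (simp only: cong_iff_dvd_diff)
  qed
  then have "regular_mod (int (l * j)) (int (d * l)) \<longleftrightarrow> coprime (int (l * j)) (int d)"
    unfolding regular_mod_def by (simp only: coprime_iff_invertible_int)
  also have "\<dots> \<longleftrightarrow> coprime d l"
    using assms(2) by (auto simp: coprime_commute)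
  finally show ?thesis .
qed

section \<open>Reindexing by coprime pairs\<close>

lemma finite_pos_upto: "finite (pos_upto x)"
  by (rule finite_subset[of _ "{..nat \<lfloor>x\<rfloor>}"]) (auto simp: pos_upto_def le_nat_floor)

lemma card_pos_upto:
  assumes "x \<ge> 0"
  shows "real (card (pos_upto x)) = of_int \<lfloor>x\<rfloor>"
proof -
  have "pos_upto x = {1..nat \<lfloor>x\<rfloor>}"
    using assms by (auto simp: pos_upto_def le_nat_floor le_nat_iff le_floor_iff)
  then show ?thesis using assms by simp
qed

lemma finite_Reg: "finite (Reg n)"
  by (rule finite_subset[of _ "{..n}"]) (auto simp: Reg_def)

lemma finite_coprime_pairs_upto: "finite (coprime_pairs_upto x)"
proof (rule finite_subset)
  show "coprime_pairs_upto x \<subseteq> pos_upto x \<times> pos_upto x"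
  proof (clarsimp simp: coprime_pairs_upto_def pos_upto_def)
    fix d l :: nat assume *: "Suc 0 \<le> d" "Suc 0 \<le> l" "real d * real l \<le> x"
    then have "d \<le> d * l" "l \<le> d * l" by auto
    then have "real d \<le> real (d * l)" "real l \<le> real (d * l)" by (simp_all only: of_nat_le_iff)
    with * show "real d \<le> x \<and> real l \<le> x" unfolding of_nat_mult by linarith
  qed
qed (simp add: finite_pos_upto)

text \<open>The bijection sends (n, k) to l = gcd(k, n), d = n / l, j = k / l. Then j is a totative
  of d, and regularity of k becomes coprimality of d and l.\<close>

lemma sum_Reg_eq_sum_coprime_pairs:
  fixes h :: "nat \<Rightarrow> nat \<Rightarrow> nat \<Rightarrow> 'a :: comm_monoid_add"
  shows "(\<Sum>n\<in>pos_upto x. \<Sum>k\<in>Reg n. h n (gcd k n) k) =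
    (\<Sum>(d, l)\<in>coprime_pairs_upto x. \<Sum>j\<in>totatives d. h (d * l) l (l * j))"
proof -
  have "(\<Sum>n\<in>pos_upto x. \<Sum>k\<in>Reg n. h n (gcd k n) k) =
      (\<Sum>(n, k)\<in>Sigma (pos_upto x) Reg. h n (gcd k n) k)"
    by (simp add: sum.Sigma finite_pos_upto finite_Reg)
  also have "\<dots> = (\<Sum>(p, j)\<in>Sigma (coprime_pairs_upto x) (\<lambda>p. totatives (fst p)).
      h (fst p * snd p) (snd p) (snd p * j))"
  proof (rule sum.reindex_bij_witness[where
        i = "\<lambda>(p, j). (fst p * snd p, snd p * j)" and
        j = "\<lambda>(n, k). ((n div gcd k n, gcd k n), k div gcd k n)"], goal_cases)
    case (1 a)
    then show ?case by (cases a) simp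
  next
    case (2 a)
    then obtain n k where a: "a = (n, k)" "n \<in> pos_upto x" "k \<in> Reg n" by auto
    define l where "l = gcd k n"
    obtain d where d: "n = l * d" unfolding l_def by (metis gcd_dvd2 dvdE)
    obtain j where j: "k = l * j" unfolding l_def by (metis gcd_dvd1 dvdE)
    have pos: "n > 0" "k > 0" "k \<le> n" "real n \<le> x"
      using a by (auto simp: pos_upto_def Reg_def)
    then have dlj: "l > 0" "d > 0" "j > 0" using d j by auto
    \<comment> \<open>Both sides equal gcd(k, n) = l, so j and d are coprime and the regularity
      criterion applies.\<close>
    have "l * gcd j d = gcd (l * j) (l * d)"
      by (rule gcd_mult_distrib_nat)
    also have "\<dots> = l * 1"
      by (simp only: d[symmetric] j[symmetric] l_def[symmetric] mult_1_right)
    finally have "l * gcd j d = l * 1" .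
    then have "gcd j d = 1" using dlj(1) by (simp only: mult_cancel1) simp
    then have cop: "coprime j d" by (simp only: coprime_iff_gcd_eq_1)
    then have "coprime d l"
      using a(3) regular_mod_iff_coprime[of l j d] dlj(1) unfolding d j
      by (simp add: Reg_def mult.commute)
    moreover have "n div l = d" "k div l = j" "real (d * l) \<le> x" "j \<le> d"
      using d j dlj pos by (simp_all add: mult.commute)
    ultimately have "(d, l) \<in> coprime_pairs_upto x" "j \<in> totatives d"
      using dlj cop by (simp_all add: coprime_pairs_upto_def totatives_def Suc_le_eq)
    then show ?case
      unfolding a(1) prod.case l_def[symmetric] \<open>n div l = d\<close> \<open>k div l = j\<close> by simp
  next
    case (3 b)
    then obtain d l j where b: "b = ((d, l), j)" "(d, l) \<in> coprime_pairs_upto x" "j \<in> totatives d"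
      by auto
    \<comment> \<open>Since j is prime to d, the gcd recovers l, and the two quotients then recover
      d and j.\<close>
    then have "gcd (l * j) (d * l) = l"
      by (simp add: totatives_def mult.commute[of d] flip: gcd_mult_distrib_nat)
    then show ?case using b by (auto simp: coprime_pairs_upto_def)
  next
    case (4 b)
    then obtain d l j where b: "b = ((d, l), j)" "(d, l) \<in> coprime_pairs_upto x" "j \<in> totatives d"
      by auto
    then have "regular_mod (int (l * j)) (int (d * l))"
      using regular_mod_iff_coprime[of l j d] by (auto simp: coprime_pairs_upto_def totatives_def)
    then show ?case
      using b by (auto simp: pos_upto_def Reg_def coprime_pairs_upto_def totatives_def mult.commute)
  next
    case (5 a)
    then show ?case by (cases a) simp
  qed
  also have "\<dots> = (\<Sum>p\<in>coprime_pairs_upto x. \<Sum>j\<in>totatives (fst p).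
      h (fst p * snd p) (snd p) (snd p * j))"
    by (simp add: sum.Sigma finite_coprime_pairs_upto)
  finally show ?thesis by (simp add: case_prod_beta)
qed

text \<open>The free weight c covers both sums: c(n) = 1 / n^(r+1) gives \<open>U_sum\<close> and
  c(n) = 1 / (n^r f(n)) gives \<open>V_sum\<close>.\<close>

lemma sum_Reg_gcd_power:
  fixes c f :: "nat \<Rightarrow> complex"
  assumes "r \<ge> 1"
  shows "(\<Sum>n\<in>pos_upto x. c n * (\<Sum>k\<in>Reg n. f (gcd k n) * of_nat k ^ r)) =
    1 / 2 * (\<Sum>n\<in>pos_upto x. c n * of_nat n ^ r * f n) +
    1 / of_nat (r + 1) *
      (\<Sum>m = 0..r div 2. of_nat ((r + 1) choose (2 * m)) * of_real (bernoulli (2 * m)) *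
        (\<Sum>(d, l)\<in>coprime_pairs_upto x.
          c (d * l) * of_nat (d * l) ^ r * f l * of_real (jordan_totient (1 - 2 * int m) d)))"
proof -
  let ?P = "coprime_pairs_upto x"
  let ?b = "\<lambda>m. of_nat ((r + 1) choose (2 * m)) * of_real (bernoulli (2 * m)) :: complex"
  let ?w = "\<lambda>p. c (fst p * snd p) * of_nat (fst p * snd p) ^ r * f (snd p)"
  let ?J = "\<lambda>m p. of_real (jordan_totient (1 - 2 * int m) (fst p)) :: complex"
  have tot: "(\<Sum>j\<in>totatives d. of_nat j ^ r) = (of_nat d ^ r * ((if d = 1 then 1 / 2 else 0) +
      1 / of_nat (r + 1) * (\<Sum>m=0..r div 2. ?b m * of_real (jordan_totient (1 - 2 * int m) d))) :: complex)"
    if "d > 0" for d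
    using arg_cong[OF sum_totatives_power[OF that assms], of complex_of_real]
    by (simp add: if_distrib[of complex_of_real] cong: if_cong)
  have "(\<Sum>n\<in>pos_upto x. c n * (\<Sum>k\<in>Reg n. f (gcd k n) * of_nat k ^ r)) =
      (\<Sum>n\<in>pos_upto x. \<Sum>k\<in>Reg n. c n * (f (gcd k n) * of_nat k ^ r))"
    by (simp only: sum_distrib_left)
  also have "\<dots> = (\<Sum>p\<in>?P. \<Sum>j\<in>totatives (fst p).
      c (fst p * snd p) * (f (snd p) * of_nat (snd p * j) ^ r))"
    by (subst sum_Reg_eq_sum_coprime_pairs[where h = "\<lambda>n l k. c n * (f l * of_nat k ^ r)"])
      (simp add: case_prod_beta)
  also have "\<dots> = (\<Sum>p\<in>?P. c (fst p * snd p) * f (snd p) * of_nat (snd p) ^ r *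
      (\<Sum>j\<in>totatives (fst p). of_nat j ^ r))"
    by (simp add: sum_distrib_left power_mult_distrib mult_ac)
  \<comment> \<open>The factor l^r from k = l j and the factor d^r from the totatives of d combine
    to (d l)^r in \<open>?w\<close>.\<close>
  also have "\<dots> = (\<Sum>p\<in>?P. (if fst p = 1 then 1 / 2 * ?w p else 0) +
      1 / of_nat (r + 1) * (\<Sum>m=0..r div 2. ?b m * (?w p * ?J m p)))"
  proof (rule sum.cong)
    fix p assume "p \<in> ?P"
    then have "fst p > 0" by (auto simp: coprime_pairs_upto_def)
    have "(\<Sum>m=0..r div 2. ?b m * (?w p * ?J m p)) = ?w p * (\<Sum>m=0..r div 2. ?b m * ?J m p)"
      by (simp add: sum_distrib_left mult_ac)
    then show "c (fst p * snd p) * f (snd p) * of_nat (snd p) ^ r *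
        (\<Sum>j\<in>totatives (fst p). of_nat j ^ r) = (if fst p = 1 then 1 / 2 * ?w p else 0) +
        1 / of_nat (r + 1) * (\<Sum>m=0..r div 2. ?b m * (?w p * ?J m p))"
      unfolding tot[OF \<open>fst p > 0\<close>]
      by (simp only: power_mult_distrib of_nat_mult) (simp add: algebra_simps)
  qed simp
  also have "\<dots> = (\<Sum>p\<in>?P. if fst p = 1 then 1 / 2 * ?w p else 0) +
      1 / of_nat (r + 1) * (\<Sum>m=0..r div 2. ?b m * (\<Sum>p\<in>?P. ?w p * ?J m p))"
    by (simp only: sum.distrib sum_distrib_left[symmetric] sum.swap[of _ "{0..r div 2}"])
  \<comment> \<open>The pairs with d = 1 are exactly (1, n) with n <= x, so a sum over single
    integers remains.\<close>
  also have "(\<Sum>p\<in>?P. if fst p = 1 then 1 / 2 * ?w p else 0) =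
      (\<Sum>p\<in>Pair 1 ` pos_upto x. 1 / 2 * ?w p)"
    by (intro sum.mono_neutral_cong_right finite_coprime_pairs_upto)
      (auto simp: coprime_pairs_upto_def pos_upto_def)
  also have "\<dots> = 1 / 2 * (\<Sum>n\<in>pos_upto x. c n * of_nat n ^ r * f n)"
    by (subst sum.reindex) (auto simp: inj_on_def sum_distrib_left)
  finally show ?thesis by (simp add: case_prod_beta)
qed

theorem theorem1p1:
  fixes f :: "nat \<Rightarrow> complex" and r :: nat and x :: real
  assumes "r \<ge> 1" and "x > 2"
  shows
    "U_sum f r x =
       1 / 2 * (\<Sum>n\<in>pos_upto x. f n / of_nat n)
       + 1 / of_nat (r + 1) *
         (\<Sum>m = 0..r div 2. of_nat ((r + 1) choose (2 * m)) * of_real (bernoulli (2 * m)) *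
            (\<Sum>(d, l)\<in>coprime_pairs_upto x.
               f l / of_nat l * (of_real (jordan_totient (1 - 2 * int m) d) / of_nat d)))
     \<and> ((\<forall>n\<ge>1. f n \<noteq> 0) \<longrightarrow>
        V_sum f r x =
          of_real (x / 2 - theta x / 2 - 1 / 4)
          + 1 / of_nat (r + 1) *
            (\<Sum>m = 0..r div 2. of_nat ((r + 1) choose (2 * m)) * of_real (bernoulli (2 * m)) *
               (\<Sum>(d, l)\<in>coprime_pairs_upto x.
                  f l * of_real (jordan_totient (1 - 2 * int m) d) / f (d * l))))"
proof (intro conjI impI)
  have "(\<Sum>n\<in>pos_upto x. 1 / of_nat n ^ (r + 1) * of_nat n ^ r * f n) =
      (\<Sum>n\<in>pos_upto x. f n / of_nat n)"
    by (intro sum.cong) (auto simp: pos_upto_def)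
  moreover have "(\<Sum>(d, l)\<in>coprime_pairs_upto x. 1 / of_nat (d * l) ^ (r + 1) * of_nat (d * l) ^ r *
      f l * of_real (jordan_totient s d)) = (\<Sum>(d, l)\<in>coprime_pairs_upto x.
        f l / of_nat l * (of_real (jordan_totient s d) / of_nat d))" for s
    by (intro sum.cong) (auto simp: coprime_pairs_upto_def)
  ultimately show "U_sum f r x =
       1 / 2 * (\<Sum>n\<in>pos_upto x. f n / of_nat n)
       + 1 / of_nat (r + 1) *
         (\<Sum>m = 0..r div 2. of_nat ((r + 1) choose (2 * m)) * of_real (bernoulli (2 * m)) *
            (\<Sum>(d, l)\<in>coprime_pairs_upto x.
               f l / of_nat l * (of_real (jordan_totient (1 - 2 * int m) d) / of_nat d)))"
    unfolding U_sum_def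
    by (subst sum_Reg_gcd_power[OF assms(1)]) (simp only:)
next
  assume nz: "\<forall>n\<ge>1. f n \<noteq> 0"
  \<comment> \<open>Here c(n) n^r f(n) = 1, so the first sum counts the integers up to x.\<close>
  have "(\<Sum>n\<in>pos_upto x. 1 / (of_nat n ^ r * f n) * of_nat n ^ r * f n) = (\<Sum>n\<in>pos_upto x. 1)"
    using nz by (intro sum.cong) (auto simp: pos_upto_def)
  also have "\<dots> = of_real (real (card (pos_upto x)))"
    by simp
  \<comment> \<open>The count is floor(x) = x - theta(x) - 1/2, and half of it is the main
    term.\<close>
  finally have "1 / 2 * (\<Sum>n\<in>pos_upto x. 1 / (of_nat n ^ r * f n) * of_nat n ^ r * f n) =
      of_real (x / 2 - theta x / 2 - 1 / 4)"
    using assms(2) by (simp only: card_pos_upto) (simp add: theta_def field_simps)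
  moreover have "(\<Sum>(d, l)\<in>coprime_pairs_upto x. 1 / (of_nat (d * l) ^ r * f (d * l)) *
      of_nat (d * l) ^ r * f l * of_real (jordan_totient s d)) = (\<Sum>(d, l)\<in>coprime_pairs_upto x.
        f l * of_real (jordan_totient s d) / f (d * l))" for s
    using nz by (intro sum.cong) (auto simp: coprime_pairs_upto_def)
  ultimately show "V_sum f r x =
          of_real (x / 2 - theta x / 2 - 1 / 4)
          + 1 / of_nat (r + 1) *
            (\<Sum>m = 0..r div 2. of_nat ((r + 1) choose (2 * m)) * of_real (bernoulli (2 * m)) *
               (\<Sum>(d, l)\<in>coprime_pairs_upto x.
                  f l * of_real (jordan_totient (1 - 2 * int m) d) / f (d * l)))"
    unfolding V_sum_def
    by (subst sum_Reg_gcd_power[OF assms(1)]) (simp only:)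
qed

end
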